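(* Let $\mathcal C\subseteq 2^{[n]}$ be a reduced code and $i\in[n]$. Then $[\mathcal C]$ covers $[\mathcal C^{(i)}]$ in $\mathbf{P}_{\mathbf{Code}}$.
   Context: A code is a subset $\mathcal C\subseteq 2^{[n]}$. For $\sigma\subseteq[n]$, $\mathrm{Tk}_{\mathcal C}(\sigma)=\{c\in\mathcal C\mid\sigma\subseteq c\}$, and $\mathrm{Tk}_{\mathcal C}(j)=\mathrm{Tk}_{\mathcal C}(\{j\})$ (simple trunks). A trunk in $\mathcal C$ is a subset of $\mathcal C$ that is empty or equal to some $\mathrm{Tk}_{\mathcal C}(\sigma)$. A morphism between codes $\mathcal C\subseteq 2^{[n]}$, $\mathcal D\subseteq 2^{[m]}$ is a function $f:\mathcal C\to\mathcal D$ such that the preimage of every trunk in $\mathcal D$ is a trunk in $\mathcal C$; an isomorphism is a bijective morphism whose inverse is a morphism. Given trunks $S_1,\ldots,S_m$ in $\mathcal C$, the morphism determined by them is $c\mapsto\{j\in[m]\mid c\in S_j\}$, $\mathcal C\to 2^{[m]}$ (its image is well defined up to isomorphism regardless of the ordering of the $S_j$). An index $i$ is trivial if $\mathrm{Tk}_{\mathcal C}(i)=\emptyset$, and redundant if $\mathrm{Tk}_{\mathcal C}(i)=\mathrm{Tk}_{\mathcal C}(\sigma)$ for some $\sigma\subseteq[n]\setminus\{i\}$; $\mathcal C$ is reduced if it has no trivial or redundant indices. For a reduced code $\mathcal C\subseteq 2^{[n]}$ with simple trunks $T_j=\mathrm{Tk}_{\mathcal C}(j)$, the $i$-th covered code $\mathcal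 C^{(i)}$ is the image of $\mathcal C$ under the morphism determined by the collection $\{T_j\mid j\neq i\}\cup\{T_j\cap T_i\mid j\neq i,\ T_j\cap T_i\neq T_i\}$. An operation on a code replaces it by one of its trunks (as a code) or by its image under a morphism. For isomorphism classes, $[\mathcal C]\le[\mathcal D]$ if a finite sequence of operations takes $\mathcal D$ to a code isomorphic to $\mathcal C$; this gives the poset $\mathbf{P}_{\mathbf{Code}}$. $[\mathcal C]$ covers $[\mathcal D]$ if $[\mathcal D]<[\mathcal C]$ with nothing strictly in between. *)

theory Defs
  imports Main
begin

text \<open>The pair \<open>(n, W)\<close> represents a code \<open>W\<close> in \<open>2^[n]\<close>, where \<open>[n]\<close> is \<open>{1..n}\<close>.\<close>

type_synonym code = "nat \<times> nat set set"

abbreviation indices :: "code \<Rightarrow> nat set" where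
  "indices C \<equiv> {1..fst C}"

abbreviation codewords :: "code \<Rightarrow> nat set set" where
  "codewords C \<equiv> snd C"

definition is_code :: "code \<Rightarrow> bool" where
  "is_code C \<longleftrightarrow> codewords C \<subseteq> Pow (indices C)"

definition Tk :: "code \<Rightarrow> nat set \<Rightarrow> nat set set" where
  "Tk C \<sigma> = {c \<in> codewords C. \<sigma> \<subseteq> c}"

definition is_trunk :: "code \<Rightarrow> nat set set \<Rightarrow> bool" where
  "is_trunk C T \<longleftrightarrow> T = {} \<or> (\<exists>\<sigma> \<subseteq> indices C. T = Tk C \<sigma>)"

definition is_morphism :: "code \<Rightarrow> code \<Rightarrow> (nat set \<Rightarrow> nat set) \<Rightarrow> bool" where
  "is_morphism C D f \<longleftrightarrow>
     f ` codewords C \<subseteq> codewords D \<and>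
     (\<forall>T. is_trunk D T \<longrightarrow> is_trunk C {c \<in> codewords C. f c \<in> T})"

definition isomorphic :: "code \<Rightarrow> code \<Rightarrow> bool" where
  "isomorphic C D \<longleftrightarrow>
     (\<exists>f. bij_betw f (codewords C) (codewords D) \<and> is_morphism C D f \<and>
          is_morphism D C (inv_into (codewords C) f))"

definition trivial_index :: "code \<Rightarrow> nat \<Rightarrow> bool" where
  "trivial_index C i \<longleftrightarrow> Tk C {i} = {}"

definition redundant_index :: "code \<Rightarrow> nat \<Rightarrow> bool" where
  "redundant_index C i \<longleftrightarrow> (\<exists>\<sigma> \<subseteq> indices C - {i}. Tk C {i} = Tk C \<sigma>)"

definition reduced :: "code \<Rightarrow> bool" where
  "reduced C \<longleftrightarrow> (\<forall>i \<in> indices C. \<not> trivial_index C i \<and> \<not> redundant_index C i)"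

text \<open>
  The morphism determined by trunks \<open>S\<^sub>1, \<dots>, S\<^sub>m\<close>, given as a list, and its image
  as a code in \<open>2^[m]\<close>. List positions start at 0, hence the shift.
\<close>

definition determined_map :: "nat set set list \<Rightarrow> nat set \<Rightarrow> nat set" where
  "determined_map Ts c = {j \<in> {1..length Ts}. c \<in> Ts ! (j - 1)}"

definition determined_image :: "code \<Rightarrow> nat set set list \<Rightarrow> code" where
  "determined_image C Ts = (length Ts, determined_map Ts ` codewords C)"

definition covered_trunks :: "code \<Rightarrow> nat \<Rightarrow> nat set set set" where
  "covered_trunks C i =
     {Tk C {j} |j. j \<in> indices C \<and> j \<noteq> i} \<union>
     {Tk C {j} \<inter> Tk C {i} |j. j \<in> indices C \<and> j \<noteq> i \<and> Tk C {j} \<inter> Tk C {i} \<noteq> Tk C {i}}"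

text \<open>
  The \<open>i\<close>-th covered code is determined by a set of trunks, so it is fixed only up to the
  choice of an ordering; the relation below admits the code arising from any ordering.
\<close>

definition is_covered_code :: "code \<Rightarrow> nat \<Rightarrow> code \<Rightarrow> bool" where
  "is_covered_code C i D \<longleftrightarrow>
     (\<exists>Ts. distinct Ts \<and> set Ts = covered_trunks C i \<and> D = determined_image C Ts)"

lemma ex_covered_code: "\<exists>D. is_covered_code C i D"
proof -
  have "finite (covered_trunks C i)"
    unfolding covered_trunks_def by simp
  then show ?thesis
    unfolding is_covered_code_def by (metis finite_distinct_list)
qed

lemma is_code_covered_code: "is_covered_code C i D \<Longrightarrow> is_code D"
  by (auto simp: is_covered_code_def is_code_def determined_image_def determined_map_def)

inductive operation :: "code \<Rightarrow> code \<Rightarrow> bool" where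
  trunk: "is_trunk C T \<Longrightarrow> operation C (fst C, T)"
| image: "is_code D \<Longrightarrow> is_morphism C D f \<Longrightarrow> operation C (fst D, f ` codewords C)"

definition iso_class :: "code \<Rightarrow> code set" where
  "iso_class C = {D. is_code D \<and> isomorphic C D}"

definition P_Code :: "code set set" where
  "P_Code = {iso_class C |C. is_code C}"

definition P_Code_le :: "code set \<Rightarrow> code set \<Rightarrow> bool" where
  "P_Code_le X Y \<longleftrightarrow>
     (\<exists>C D E. is_code C \<and> is_code D \<and> X = iso_class C \<and> Y = iso_class D \<and>
              operation\<^sup>*\<^sup>* D E \<and> isomorphic E C)"

definition P_Code_less :: "code set \<Rightarrow> code set \<Rightarrow> bool" where
  "P_Code_less X Y \<longleftrightarrow> P_Code_le X Y \<and> X \<noteq> Y"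

definition P_Code_covers :: "code set \<Rightarrow> code set \<Rightarrow> bool" where
  "P_Code_covers Y X \<longleftrightarrow>
     P_Code_less X Y \<and> \<not> (\<exists>Z \<in> P_Code. P_Code_less X Z \<and> P_Code_less Z Y)"

end

theory Submission
  imports Defs
begin

text \<open>
  The number of trunks is a strictly monotone rank on the poset: pulling back along the surjection
  onto an image embeds the trunks of the image into those of the code, and the trunks of a trunk
  are trunks of the code; if no trunk is lost, the operation is an isomorphism. In a reduced code
  the trunk \<open>Tk C {i}\<close> is the only nonempty trunk not an intersection of the trunks determining
  the \<open>i\<close>-th covered code, so the covered code has exactly one trunk less than the code.
\<close>

section \<open>The finite, intersection-closed family of trunks of a code\<close>

definition trunks :: "code \<Rightarrow> nat set set set" where
  "trunks C = {T. is_trunk C T}"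

lemma trunks_eq: "trunks C = insert {} (Tk C ` Pow (indices C))"
  by (auto simp: trunks_def is_trunk_def)

lemma finite_trunks: "finite (trunks C)"
  by (simp add: trunks_eq)

lemma trunks_subset_codewords: "T \<in> trunks C \<Longrightarrow> T \<subseteq> codewords C"
  by (auto simp: trunks_eq Tk_def)

lemma empty_in_trunks: "{} \<in> trunks C"
  by (simp add: trunks_eq)

lemma codewords_in_trunks: "codewords C \<in> trunks C"
  by (force simp: trunks_eq Tk_def)

lemma Tk_in_trunks: "\<sigma> \<subseteq> indices C \<Longrightarrow> Tk C \<sigma> \<in> trunks C"
  by (simp add: trunks_eq)

lemma Tk_Un: "Tk C (\<sigma> \<union> \<tau>) = Tk C \<sigma> \<inter> Tk C \<tau>"
  by (auto simp: Tk_def)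

lemma Tk_eq_INT: "Tk C \<sigma> = codewords C \<inter> (\<Inter>j\<in>\<sigma>. Tk C {j})"
  by (auto simp: Tk_def)

lemma trunks_Int: "S \<in> trunks C \<Longrightarrow> T \<in> trunks C \<Longrightarrow> S \<inter> T \<in> trunks C"
  by (auto simp: trunks_eq simp flip: Tk_Un)

text \<open>By induction from binary intersections. The factor \<open>codewords C\<close> gives the
  empty family its right value, since \<open>\<Inter>{}\<close> would be the universe.\<close>

lemma trunks_Inter:
  assumes "\<U> \<subseteq> trunks C"
  shows "codewords C \<inter> \<Inter>\<U> \<in> trunks C"
proof -
  have "finite \<U>"
    using assms finite_trunks by (rule finite_subset)
  then show ?thesis
    using assms
  proof (induction \<U>)
    case empty
    then show ?case by (simp add: codewords_in_trunks)
  next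
    case (insert U \<U>)
    then have "U \<in> trunks C" "codewords C \<inter> \<Inter>\<U> \<in> trunks C"
      by auto
    then have "U \<inter> (codewords C \<inter> \<Inter>\<U>) \<in> trunks C"
      by (rule trunks_Int)
    then show ?case by (simp add: Int_left_commute)
  qed
qed

section \<open>Morphisms and isomorphisms in terms of trunk families\<close>

lemma is_morphism_iff:
  "is_morphism C D f \<longleftrightarrow>
     f ` codewords C \<subseteq> codewords D \<and> (\<forall>T\<in>trunks D. f -` T \<inter> codewords C \<in> trunks C)"
proof -
  have "f -` T \<inter> codewords C = {c \<in> codewords C. f c \<in> T}" for T
    by auto
  then show ?thesis
    by (simp add: is_morphism_def trunks_def)
qed

text \<open>For a fixed bijection \<open>f\<close> each morphism condition is one inclusion:
  \<open>f\<close> is a morphism iff every trunk of \<open>D\<close> is the image of a trunk of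
  \<open>C\<close>, and its inverse is one iff images of trunks are trunks. In this form symmetry,
  transitivity and invariance of the trunk count follow directly.\<close>

lemma isomorphic_iff:
  "isomorphic C D \<longleftrightarrow>
     (\<exists>f. bij_betw f (codewords C) (codewords D) \<and> (`) f ` trunks C = trunks D)"
proof -
  have "is_morphism C D f \<and> is_morphism D C (inv_into (codewords C) f) \<longleftrightarrow>
      (`) f ` trunks C = trunks D"
    if f: "bij_betw f (codewords C) (codewords D)" for f
  proof -
    let ?g = "inv_into (codewords C) f"
    have g: "?g ` codewords D \<subseteq> codewords C"
      using bij_betw_inv_into[OF f] by (auto simp: bij_betw_def)
    have img: "f ` codewords C = codewords D" and inj: "inj_on f (codewords C)"
      using f by (auto simp: bij_betw_def)
    have push: "?g -` T \<inter> codewords D = f ` T" if "T \<subseteq> codewords C" for T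
      using that inj by (auto simp: inv_into_f_f subset_iff simp flip: img)
    have pull: "f ` (f -` T \<inter> codewords C) = T" if "T \<subseteq> codewords D" for T
      using that by (auto simp flip: img)
    have pull': "f -` (f ` T) \<inter> codewords C = T" if "T \<subseteq> codewords C" for T
      using that inj by (auto dest: inj_onD)
    have "is_morphism D C ?g \<longleftrightarrow> (`) f ` trunks C \<subseteq> trunks D"
      using g push trunks_subset_codewords by (auto simp: is_morphism_iff)
    moreover have "is_morphism C D f \<longleftrightarrow> trunks D \<subseteq> (`) f ` trunks C"
    proof
      assume "is_morphism C D f"
      then show "trunks D \<subseteq> (`) f ` trunks C"
        using pull trunks_subset_codewords unfolding is_morphism_iff
        by (metis image_eqI subsetI)
    next
      assume "trunks D \<subseteq> (`) f ` trunks C"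
      then show "is_morphism C D f"
        using pull' img trunks_subset_codewords unfolding is_morphism_iff
        by (smt (verit, best) imageE subsetD subset_refl)
    qed
    ultimately show ?thesis by blast
  qed
  then show ?thesis
    unfolding isomorphic_def by blast
qed

lemma isomorphic_refl: "isomorphic C C"
  unfolding isomorphic_iff by (intro exI[of _ id]) simp

lemma isomorphic_sym:
  assumes "isomorphic C D"
  shows "isomorphic D C"
proof -
  obtain f where f: "bij_betw f (codewords C) (codewords D)" "(`) f ` trunks C = trunks D"
    using assms by (auto simp: isomorphic_iff)
  let ?g = "inv_into (codewords C) f"
  have "?g ` f ` T = T" if "T \<in> trunks C" for T
    using f(1) trunks_subset_codewords[OF that]
    by (simp add: bij_betw_def inv_into_image_cancel)
  then have "(`) ?g ` trunks D = trunks C"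
    by (simp add: image_image flip: f(2))
  then show ?thesis
    unfolding isomorphic_iff by (intro exI[of _ ?g] conjI bij_betw_inv_into[OF f(1)])
qed

lemma isomorphic_trans:
  assumes "isomorphic C D" "isomorphic D E"
  shows "isomorphic C E"
proof -
  obtain f g where
    "bij_betw f (codewords C) (codewords D)" "(`) f ` trunks C = trunks D"
    "bij_betw g (codewords D) (codewords E)" "(`) g ` trunks D = trunks E"
    using assms by (auto simp: isomorphic_iff)
  moreover have "(`) (g \<circ> f) ` trunks C = (`) g ` (`) f ` trunks C"
    by (simp add: image_image o_def)
  ultimately have "bij_betw (g \<circ> f) (codewords C) (codewords E)"
      "(`) (g \<circ> f) ` trunks C = trunks E"
    by (simp_all add: bij_betw_trans)
  then show ?thesis
    unfolding isomorphic_iff by blast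
qed

lemma isomorphic_card_trunks:
  assumes "isomorphic C D"
  shows "card (trunks C) = card (trunks D)"
proof -
  obtain f where f: "bij_betw f (codewords C) (codewords D)" "(`) f ` trunks C = trunks D"
    using assms by (auto simp: isomorphic_iff)
  have "inj_on ((`) f) (trunks C)"
    using f(1) trunks_subset_codewords
    by (intro inj_onI) (metis bij_betw_def inj_on_image_eq_iff)
  then show ?thesis
    using f(2) card_image by fastforce
qed

text \<open>Since \<open>iso_class\<close> collects only codes, \<open>is_code C\<close> is what
  puts \<open>C\<close> into its own class and lets equal classes yield an isomorphism.\<close>

lemma iso_class_eq_iff:
  assumes "is_code C"
  shows "iso_class C = iso_class D \<longleftrightarrow> isomorphic C D"
proof
  assume "iso_class C = iso_class D"
  moreover have "C \<in> iso_class C"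
    using assms by (simp add: iso_class_def isomorphic_refl)
  ultimately have "C \<in> iso_class D"
    by simp
  then show "isomorphic C D"
    by (simp add: iso_class_def isomorphic_sym)
next
  assume "isomorphic C D"
  then have "isomorphic C E \<longleftrightarrow> isomorphic D E" for E
    using isomorphic_sym isomorphic_trans by metis
  then show "iso_class C = iso_class D"
    by (simp add: iso_class_def)
qed

section \<open>Images of codes under morphisms\<close>

definition image_code :: "code \<Rightarrow> code \<Rightarrow> (nat set \<Rightarrow> nat set) \<Rightarrow> code" where
  "image_code C D f = (fst D, f ` codewords C)"

text \<open>Trunks of the image are traces of trunks of \<open>D\<close> on the range of
  \<open>f\<close>, so they have the same preimages.\<close>

lemma is_morphism_image_code:
  assumes "is_morphism C D f"
  shows "is_morphism C (image_code C D f) f"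
proof -
  let ?E = "image_code C D f"
  have "f -` Tk ?E \<sigma> \<inter> codewords C = f -` Tk D \<sigma> \<inter> codewords C" for \<sigma>
    using assms by (auto simp: image_code_def Tk_def is_morphism_iff)
  moreover have "codewords ?E = f ` codewords C" "indices ?E = indices D"
    by (simp_all add: image_code_def)
  ultimately show ?thesis
    using assms by (auto simp: is_morphism_iff trunks_eq[of ?E] trunks_eq[of D])
qed

text \<open>A trunk of the image lies in the range of \<open>f\<close>, so it is recovered from its
  preimage.\<close>

lemma inj_on_vimage_trunks_image_code:
  "inj_on (\<lambda>T. f -` T \<inter> codewords C) (trunks (image_code C D f))"
proof (rule inj_onI)
  fix S T
  assume "S \<in> trunks (image_code C D f)" "T \<in> trunks (image_code C D f)"
    and eq: "f -` S \<inter> codewords C = f -` T \<inter> codewords C"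
  then have "S \<subseteq> f ` codewords C" "T \<subseteq> f ` codewords C"
    by (auto simp: image_code_def dest!: trunks_subset_codewords)
  then show "S = T"
    using eq by blast
qed

text \<open>A codeword is determined by the trunks containing it, so \<open>f\<close> below is injective.\<close>

lemma isomorphic_image_code:
  assumes "is_code C" "is_morphism C D f"
    and surj: "trunks C \<subseteq> (\<lambda>T. f -` T \<inter> codewords C) ` trunks (image_code C D f)"
  shows "isomorphic C (image_code C D f)"
proof -
  let ?E = "image_code C D f"
  have sub: "c \<subseteq> d" if "c \<in> codewords C" "d \<in> codewords C" "f c = f d" for c d
  proof -
    \<comment> \<open>The codeword \<open>c\<close> itself serves as index set; a trunk that is a
      preimage under \<open>f\<close> and contains \<open>c\<close> also contains
      \<open>d\<close>.\<close>
    have "Tk C c \<in> trunks C"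
      using assms(1) that(1) by (intro Tk_in_trunks) (auto simp: is_code_def)
    then obtain T where "Tk C c = f -` T \<inter> codewords C"
      using surj by auto
    moreover have "c \<in> Tk C c"
      using that(1) by (simp add: Tk_def)
    ultimately have "d \<in> Tk C c"
      using that by auto
    then show ?thesis by (simp add: Tk_def)
  qed
  have "inj_on f (codewords C)"
    using sub by (intro inj_onI) (simp add: subset_antisym)
  then have "bij_betw f (codewords C) (codewords ?E)"
    by (simp add: bij_betw_def image_code_def)
  moreover have "(`) f ` trunks C = trunks ?E"
  proof -
    have "f ` (f -` T \<inter> codewords C) = T" if "T \<in> trunks ?E" for T
      using trunks_subset_codewords[OF that] by (auto simp: image_code_def)
    moreover have "trunks C = (\<lambda>T. f -` T \<inter> codewords C) ` trunks ?E"
      using surj is_morphism_image_code[OF assms(2)] by (auto simp: is_morphism_iff)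
    ultimately show ?thesis
      by (simp add: image_image)
  qed
  ultimately show ?thesis
    unfolding isomorphic_iff by blast
qed

section \<open>Operations never increase the number of trunks\<close>

lemma is_code_operation: "operation C D \<Longrightarrow> is_code C \<Longrightarrow> is_code D"
proof (induction rule: operation.induct)
  case (trunk C T)
  then have "T \<subseteq> codewords C"
    by (simp add: trunks_def trunks_subset_codewords)
  then show ?case
    using trunk.prems by (auto simp: is_code_def)
next
  case (image D C f)
  then show ?case
    unfolding is_code_def is_morphism_def fst_conv snd_conv by (meson order_trans)
qed

lemma operation_card_trunks:
  assumes "operation C D" "is_code C"
  shows "card (trunks D) < card (trunks C) \<or> isomorphic C D"
  using assms
proof (induction rule: operation.induct)
  case (trunk C T)
  then have T: "T \<in> trunks C" by (simp add: trunks_def)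
  have "Tk (fst C, T) \<sigma> = T \<inter> Tk C \<sigma>" for \<sigma>
    using trunks_subset_codewords[OF T] by (auto simp: Tk_def)
  then have sub: "trunks (fst C, T) \<subseteq> trunks C"
    using T by (auto simp: trunks_eq[of "(fst C, T)"] empty_in_trunks intro!: trunks_Int Tk_in_trunks)
  show ?case
  proof (cases "T = codewords C")
    case True
    then show ?thesis by (simp add: isomorphic_refl)
  next
    case False
    \<comment> \<open>The trunks of a proper trunk \<open>T\<close> lie inside \<open>T\<close>, so
      at least the trunk \<open>codewords C\<close> is lost.\<close>
    then have "codewords C \<notin> trunks (fst C, T)"
      using trunks_subset_codewords[of "codewords C" "(fst C, T)"] trunks_subset_codewords[OF T]
      by auto
    then have "trunks (fst C, T) \<subset> trunks C"
      using sub codewords_in_trunks by blast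
    then show ?thesis
      by (simp add: psubset_card_mono finite_trunks)
  qed
next
  case (image D C f)
  let ?pull = "\<lambda>T. f -` T \<inter> codewords C"
  have "?pull ` trunks (image_code C D f) \<subseteq> trunks C"
    using is_morphism_image_code[OF image.hyps(2)] by (auto simp: is_morphism_iff)
  moreover have "card (?pull ` trunks (image_code C D f)) = card (trunks (image_code C D f))"
    by (rule card_image[OF inj_on_vimage_trunks_image_code])
  ultimately have "card (trunks (image_code C D f)) < card (trunks C) \<or>
      isomorphic C (image_code C D f)"
    using isomorphic_image_code[OF image.prems image.hyps(2)] psubset_card_mono[OF finite_trunks]
    by (metis psubsetI subset_refl)
  then show ?case by (simp add: image_code_def)
qed

lemma operations_card_trunks:
  assumes "operation\<^sup>*\<^sup>* C D" "is_code C"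
  shows "is_code D \<and> (card (trunks D) < card (trunks C) \<or> isomorphic C D)"
  using assms
proof (induction rule: rtranclp_induct)
  case base
  then show ?case by (simp add: isomorphic_refl)
next
  case (step D E)
  then have "is_code D" "is_code E" "card (trunks E) < card (trunks D) \<or> isomorphic D E"
    using is_code_operation operation_card_trunks by blast+
  with step show ?case
    by (metis isomorphic_card_trunks isomorphic_trans less_trans)
qed

text \<open>The representatives supplied by \<open>P_Code_le\<close> need not be \<open>C\<close>
  and \<open>D\<close>, but isomorphic codes have equally many trunks. An isomorphism at the end of
  the operations is excluded because the classes differ.\<close>

lemma P_Code_less_card_trunks:
  assumes "P_Code_less (iso_class C) (iso_class D)" "is_code C" "is_code D"
  shows "card (trunks C) < card (trunks D)"
proof -
  obtain C' D' E where *: "is_code C'" "is_code D'" "iso_class C = iso_class C'"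
      "iso_class D = iso_class D'" "operation\<^sup>*\<^sup>* D' E" "isomorphic E C'"
    using assms(1) unfolding P_Code_less_def P_Code_le_def by blast
  then have "isomorphic C C'" "isomorphic D D'"
    using assms(2,3) by (simp_all flip: iso_class_eq_iff)
  moreover have "\<not> isomorphic D' E"
  proof
    assume "isomorphic D' E"
    then have "iso_class D' = iso_class C'"
      using *(2,6) iso_class_eq_iff isomorphic_trans by blast
    then show False
      using assms(1) *(3,4) by (simp add: P_Code_less_def)
  qed
  ultimately show ?thesis
    using operations_card_trunks[OF *(5,2)] isomorphic_card_trunks[OF *(6)]
    by (simp add: isomorphic_card_trunks)
qed

section \<open>The covered code and its trunks\<close>

text \<open>The trunk of an index set \<open>\<sigma>\<close> in the image pulls back to the
  intersection of the listed trunks at the positions in \<open>\<sigma>\<close>, and every subfamily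
  of the list arises from some \<open>\<sigma>\<close>.\<close>

lemma vimage_trunks_determined_image:
  "(\<lambda>T. determined_map Ts -` T \<inter> codewords C) ` trunks (determined_image C Ts) =
     insert {} ((\<lambda>\<U>. codewords C \<inter> \<Inter>\<U>) ` Pow (set Ts))"
proof -
  let ?E = "determined_image C Ts" and ?nth = "\<lambda>j. Ts ! (j - 1)"
  have pull: "determined_map Ts -` Tk ?E \<sigma> \<inter> codewords C = codewords C \<inter> \<Inter>(?nth ` \<sigma>)"
    if "\<sigma> \<in> Pow (indices ?E)" for \<sigma>
    using that by (auto simp: determined_image_def determined_map_def Tk_def)
  have "set Ts = ?nth ` indices ?E"
  proof -
    \<comment> \<open>List positions start at 0, indices of the code at 1.\<close>
    have "{..<length Ts} = (\<lambda>j. j - 1) ` {1..length Ts}"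
      by (force simp: image_iff)
    then show ?thesis
      by (metis determined_image_def fst_conv image_image lessThan_atLeast0 list.set_map map_nth set_upt)
  qed
  then have "Pow (set Ts) = (`) ?nth ` Pow (indices ?E)"
    by (simp add: image_Pow_surj)
  moreover have "(\<lambda>T. determined_map Ts -` T \<inter> codewords C) ` Tk ?E ` Pow (indices ?E) =
      (\<lambda>\<U>. codewords C \<inter> \<Inter>\<U>) ` (`) ?nth ` Pow (indices ?E)"
    unfolding image_image by (intro image_cong refl pull)
  ultimately show ?thesis
    by (simp only: trunks_eq image_insert vimage_empty Int_empty_left)
qed

lemma determined_map_is_morphism:
  assumes "set Ts \<subseteq> trunks C"
  shows "is_morphism C (determined_image C Ts) (determined_map Ts)"
proof -
  have "(\<lambda>T. determined_map Ts -` T \<inter> codewords C) ` trunks (determined_image C Ts) \<subseteq> trunks C"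
    unfolding vimage_trunks_determined_image using assms
    by (auto simp: empty_in_trunks intro!: trunks_Inter)
  then show ?thesis
    by (auto simp: is_morphism_iff determined_image_def)
qed

lemma covered_trunks_subset_trunks:
  assumes "i \<in> indices C"
  shows "covered_trunks C i \<subseteq> trunks C"
  using assms by (auto simp: covered_trunks_def intro!: trunks_Int Tk_in_trunks)

text \<open>An intersection equal to \<open>Tk C {i}\<close> would use only simple trunks of other
  indices and so make \<open>i\<close> redundant. Conversely, any other nonempty trunk is an
  intersection of simple trunks, where a factor \<open>Tk C {i}\<close> can be distributed over the
  remaining ones.\<close>

lemma intersections_covered_trunks:
  assumes "reduced C" "i \<in> indices C"
  shows "insert {} ((\<lambda>\<U>. codewords C \<inter> \<Inter>\<U>) ` Pow (covered_trunks C i)) = trunks C - {Tk C {i}}"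
proof (intro equalityI subsetI)
  let ?T = "\<lambda>j. Tk C {j}"
  have red: "?T i \<noteq> {}" "\<And>\<sigma>. \<sigma> \<subseteq> indices C - {i} \<Longrightarrow> ?T i \<noteq> Tk C \<sigma>"
    using assms by (auto simp: reduced_def trivial_index_def redundant_index_def)
  fix T assume "T \<in> insert {} ((\<lambda>\<U>. codewords C \<inter> \<Inter>\<U>) ` Pow (covered_trunks C i))"
  then consider "T = {}" |
    \<U> where "\<U> \<subseteq> covered_trunks C i" "T = codewords C \<inter> \<Inter>\<U>" by auto
  then show "T \<in> trunks C - {?T i}"
  proof cases
    case 1
    then show ?thesis using red(1) by (auto simp: empty_in_trunks)
  next
    case 2
    have "T \<in> trunks C"
      using 2 covered_trunks_subset_trunks[OF assms(2)] by (auto intro: trunks_Inter)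
    moreover have "T \<noteq> ?T i"
    proof
      assume T: "T = ?T i"
      \<comment> \<open>Every \<open>U\<close> contains \<open>Tk C {i}\<close>, whereas the second
        kind of covered trunk is a proper subset of it.\<close>
      have "\<exists>j \<in> indices C - {i}. U = ?T j" if "U \<in> \<U>" for U
      proof -
        have "?T i \<subseteq> U" "U \<in> covered_trunks C i"
          using that 2 T by auto
        then show ?thesis
          unfolding covered_trunks_def by blast
      qed
      then have "\<U> \<subseteq> ?T ` (indices C - {i})"
        by auto
      then obtain \<sigma> where "\<sigma> \<subseteq> indices C - {i}" "\<U> = ?T ` \<sigma>"
        by (meson subset_imageE)
      then show False
        using red(2) 2 T Tk_eq_INT by metis
    qed
    ultimately show ?thesis by blast
  qed
next
  let ?T = "\<lambda>j. Tk C {j}"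
  fix T assume T: "T \<in> trunks C - {?T i}"
  show "T \<in> insert {} ((\<lambda>\<U>. codewords C \<inter> \<Inter>\<U>) ` Pow (covered_trunks C i))"
  proof (cases "T = {}")
    case False
    then obtain \<sigma> where \<sigma>: "\<sigma> \<subseteq> indices C" "T = Tk C \<sigma>"
      using T by (auto simp: trunks_eq)
    have "\<exists>\<U> \<subseteq> covered_trunks C i. T = codewords C \<inter> \<Inter>\<U>"
    proof (cases "i \<in> \<sigma>")
      case False
      then have "?T ` \<sigma> \<subseteq> covered_trunks C i"
        using \<sigma>(1) unfolding covered_trunks_def by blast
      then show ?thesis
        using \<sigma>(2) Tk_eq_INT by metis
    next
      case True
      \<comment> \<open>Discards \<open>i\<close> and every \<open>j\<close> whose trunk contains
        \<open>Tk C {i}\<close>; they do not affect an intersection with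
        \<open>Tk C {i}\<close>.\<close>
      define \<tau> where "\<tau> = {j \<in> \<sigma>. ?T j \<inter> ?T i \<noteq> ?T i}"
      have T_eq: "T = ?T i \<inter> (\<Inter>j\<in>\<tau>. ?T j \<inter> ?T i)"
        using True unfolding \<sigma>(2) Tk_eq_INT[of C \<sigma>] \<tau>_def by (auto simp: Tk_def)
      \<comment> \<open>An empty \<open>\<tau>\<close> would make \<open>T\<close> the excluded
        trunk \<open>Tk C {i}\<close>. As \<open>\<tau>\<close> is nonempty, the separate factor
        \<open>Tk C {i}\<close> is absorbed by the others.\<close>
      then have "\<tau> \<noteq> {}"
        using T by auto
      then have "T = codewords C \<inter> (\<Inter>j\<in>\<tau>. ?T j \<inter> ?T i)"
        using T_eq by (auto simp: Tk_def)
      moreover have "(\<lambda>j. ?T j \<inter> ?T i) ` \<tau> \<subseteq> covered_trunks C i"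
      proof -
        have "j \<in> indices C" "j \<noteq> i" "?T j \<inter> ?T i \<noteq> ?T i" if "j \<in> \<tau>" for j
          using that \<sigma>(1) by (auto simp: \<tau>_def)
        then show ?thesis
          unfolding covered_trunks_def by blast
      qed
      ultimately show ?thesis by blast
    qed
    then show ?thesis by blast
  qed simp
qed

text \<open>Pulling back along the determined map is a bijection from the trunks of \<open>D\<close>
  onto those of \<open>C\<close> other than \<open>Tk C {i}\<close>.\<close>

lemma card_trunks_covered_code:
  assumes "reduced C" "i \<in> indices C" "is_covered_code C i D"
  shows "card (trunks C) = Suc (card (trunks D))"
proof -
  obtain Ts where Ts: "set Ts = covered_trunks C i" "D = determined_image C Ts"
    using assms(3) by (auto simp: is_covered_code_def)
  have "D = image_code C D (determined_map Ts)"
    by (simp add: Ts(2) image_code_def determined_image_def)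
  then have "inj_on (\<lambda>T. determined_map Ts -` T \<inter> codewords C) (trunks D)"
    using inj_on_vimage_trunks_image_code by metis
  then have "card (trunks D) = card (trunks C - {Tk C {i}})"
    using vimage_trunks_determined_image[of Ts C] intersections_covered_trunks[OF assms(1,2)]
    by (metis Ts card_image)
  then show ?thesis
    using card.remove[OF finite_trunks Tk_in_trunks[of "{i}" C]] assms(2) by simp
qed

lemma operation_covered_code:
  assumes "i \<in> indices C" "is_covered_code C i D"
  shows "operation C D"
proof -
  obtain Ts where Ts: "set Ts = covered_trunks C i" "D = determined_image C Ts"
    using assms(2) by (auto simp: is_covered_code_def)
  have "is_morphism C D (determined_map Ts)"
    using determined_map_is_morphism covered_trunks_subset_trunks[OF assms(1)] Ts by metis
  then have "operation C (fst D, determined_map Ts ` codewords C)"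
    using is_code_covered_code[OF assms(2)] by (rule operation.image[rotated])
  then show ?thesis
    by (simp add: Ts(2) determined_image_def)
qed

theorem theorem3p20:
  fixes C C_i :: code and i :: nat
  assumes "is_code C"
    and "reduced C"
    and "i \<in> indices C"
    and "is_covered_code C i C_i"
  shows "P_Code_covers (iso_class C) (iso_class C_i)"
proof -
  note code = is_code_covered_code[OF assms(4)]
  note card = card_trunks_covered_code[OF assms(2-4)]
  have "P_Code_le (iso_class C_i) (iso_class C)"
    unfolding P_Code_le_def
    using assms(1) code operation_covered_code[OF assms(3,4)] isomorphic_refl by blast
  moreover have "iso_class C_i \<noteq> iso_class C"
    using card isomorphic_card_trunks iso_class_eq_iff[OF code] by fastforce
  \<comment> \<open>A class strictly in between would need a trunk count strictly between two
    consecutive numbers.\<close>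
  moreover have False
    if "is_code E" "P_Code_less (iso_class C_i) (iso_class E)" "P_Code_less (iso_class E) (iso_class C)" for E
    using P_Code_less_card_trunks[OF that(2) code that(1)]
      P_Code_less_card_trunks[OF that(3,1) assms(1)] card by simp
  ultimately show ?thesis
    unfolding P_Code_covers_def P_Code_less_def[of "iso_class C_i" "iso_class C"] P_Code_def
    by blast
qed

end
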